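(* Let $\mu_1,\mu_2$ be sub-distributions over countable sets $A_1,A_2$, let $R\subseteq A_1\times A_2$, and let $\varepsilon,\delta$ be reals. There exists a sub-distribution $\mu$ over $A_1\times A_2$ with $\pi_1(\mu)\le\mu_1$, $\pi_2(\mu)\le\mu_2$ (pointwise), $\mathrm{supp}(\mu)\subseteq R$ and $d_\varepsilon(\mu_1,\pi_1(\mu))\le\delta$, if and only if there is an $(\varepsilon,\delta)$-approximate lifting of $R$ relating $\mu_1$ and $\mu_2$.
   Context: A sub-distribution over a countable set $A$ is $\mu:A\to[0,1]$ with $\sum_a\mu(a)\le1$; $\mu(X)=\sum_{a\in X}\mu(a)$. Marginals of $\mu$ over $A_1\times A_2$ are $\pi_1(\mu)(a_1)=\sum_{a_2}\mu(a_1,a_2)$, $\pi_2(\mu)(a_2)=\sum_{a_1}\mu(a_1,a_2)$. $d_\varepsilon(\nu_1,\nu_2)=\max_{X}(\nu_1(X)-e^{\varepsilon}\nu_2(X))$. With a fresh element $\star$, $A^\star=A\cup\{\star\}$ and $R^\star=R\cup(A_1\times\{\star\})\cup(\{\star\}\times A_2)$. An $(\varepsilon,\delta)$-approximate $R$-lifting of $(\mu_1,\mu_2)$ exists if there are sub-distributions $\mu_L,\mu_R$ over $A_1^\star\times A_2^\star$ with $\pi_1(\mu_L)=\mu_1$, $\pi_2(\mu_R)=\mu_2$ (with $\mu_i(\star)=0$), $\mathrm{supp}(\mu_L)\cup\mathrm{supp}(\mu_R)\subseteq R^\star$, and $d_\varepsilon(\mu_L,\mu_R)\le\delta$.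
   Formalization: The formal theorem assumes ε ≥ 0; for negative ε the equivalence fails (e.g. one-point sets, R full, μ1 = 1/2, μ2 = 1, ε = −ln 2, δ = 0: a lifting exists but no such μ). *)

theory Defs
  imports "HOL-Probability.Probability"
begin

text \<open>
  A sub-distribution over a set is an \<open>spmf\<close> whose support lies in that set: \<open>spmf \<mu> a\<close> is \<open>\<mu>(a)\<close>,
  \<open>set_spmf \<mu>\<close> is the support of \<open>\<mu>\<close>, \<open>measure (measure_spmf \<mu>) X\<close> is \<open>\<mu>(X)\<close>, and the marginals
  are \<open>map_spmf fst \<mu>\<close> and \<open>map_spmf snd \<mu>\<close>. The first three lemmas relate the last two to sums
  of point masses.
\<close>

definition subdists :: "'a set \<Rightarrow> 'a spmf set" where
  "subdists A = {\<mu>. set_spmf \<mu> \<subseteq> A}"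

lemma measure_spmf_eq_infsum:
  "measure (measure_spmf \<mu>) X = (\<Sum>\<^sub>\<infinity>a\<in>X. spmf \<mu> a)"
proof -
  have "measure (measure_spmf \<mu>) X = infsetsum (pmf \<mu>) (Some ` X)"
    by (simp add: measure_measure_spmf_conv_measure_pmf measure_pmf_conv_infsetsum)
  also have "\<dots> = infsum (pmf \<mu>) (Some ` X)"
    by (intro infsetsum_infsum pmf_abs_summable)
  also have "\<dots> = (\<Sum>\<^sub>\<infinity>a\<in>X. spmf \<mu> a)"
    by (subst infsum_reindex) (auto simp: o_def)
  finally show ?thesis .
qed

lemma spmf_map_fst:
  fixes \<mu> :: "('a \<times> 'b) spmf"
  shows "spmf (map_spmf fst \<mu>) a = (\<Sum>\<^sub>\<infinity>b. spmf \<mu> (a, b))"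
proof -
  have "fst -` {a} = Pair a ` (UNIV :: 'b set)" by auto
  then have "spmf (map_spmf fst \<mu>) a = infsum (spmf \<mu>) (Pair a ` UNIV)"
    by (simp only: spmf_map measure_spmf_eq_infsum)
  also have "\<dots> = (\<Sum>\<^sub>\<infinity>b. spmf \<mu> (a, b))"
    by (subst infsum_reindex) (auto simp: o_def inj_on_def)
  finally show ?thesis .
qed

lemma spmf_map_snd:
  fixes \<mu> :: "('a \<times> 'b) spmf"
  shows "spmf (map_spmf snd \<mu>) b = (\<Sum>\<^sub>\<infinity>a. spmf \<mu> (a, b))"
proof -
  have "snd -` {b} = (\<lambda>a. (a, b)) ` (UNIV :: 'a set)" by auto
  then have "spmf (map_spmf snd \<mu>) b = infsum (spmf \<mu>) ((\<lambda>a. (a, b)) ` UNIV)"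
    by (simp only: spmf_map measure_spmf_eq_infsum)
  also have "\<dots> = (\<Sum>\<^sub>\<infinity>a. spmf \<mu> (a, b))"
    by (subst infsum_reindex) (auto simp: o_def inj_on_def)
  finally show ?thesis .
qed

definition skew_dist :: "'a set \<Rightarrow> real \<Rightarrow> 'a spmf \<Rightarrow> 'a spmf \<Rightarrow> real" where
  "skew_dist A \<epsilon> \<nu>1 \<nu>2 =
     (SUP X\<in>Pow A. measure (measure_spmf \<nu>1) X - exp \<epsilon> * measure (measure_spmf \<nu>2) X)"

text \<open>The supremum is a maximum.\<close>

lemma skew_dist_attained:
  "\<exists>X\<subseteq>A. (\<forall>Y\<subseteq>A. measure (measure_spmf \<nu>1) Y - exp \<epsilon> * measure (measure_spmf \<nu>2) Y
                  \<le> measure (measure_spmf \<nu>1) X - exp \<epsilon> * measure (measure_spmf \<nu>2) X) \<and>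
         skew_dist A \<epsilon> \<nu>1 \<nu>2 = measure (measure_spmf \<nu>1) X - exp \<epsilon> * measure (measure_spmf \<nu>2) X"
proof -
  define f where "f X = measure (measure_spmf \<nu>1) X - exp \<epsilon> * measure (measure_spmf \<nu>2) X" for X
  define P where "P = {a\<in>A. spmf \<nu>1 a \<ge> exp \<epsilon> * spmf \<nu>2 a}"
  have s: "(\<lambda>a. spmf \<nu> a) summable_on X" for \<nu> :: "'a spmf" and X
  proof -
    have "pmf \<nu> summable_on (Some ` X)"
      using pmf_abs_summable[of \<nu> "Some ` X"]
      by (simp add: abs_summable_equivalent[symmetric] abs_summable_summable)
    then show ?thesis by (subst (asm) summable_on_reindex) (auto simp: o_def)
  qed
  have f: "f X = (\<Sum>\<^sub>\<infinity>a\<in>X. spmf \<nu>1 a - exp \<epsilon> * spmf \<nu>2 a)" for X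
    using infsum_add[OF s[of \<nu>1 X] summable_on_cmult_right[OF s[of \<nu>2 X], of "- exp \<epsilon>"]]
    unfolding f_def measure_spmf_eq_infsum by (simp add: infsum_cmult_right' infsum_uminus)
  have d: "(\<lambda>a. spmf \<nu>1 a - exp \<epsilon> * spmf \<nu>2 a) summable_on X" for X
    using summable_on_add[OF s[of \<nu>1 X] summable_on_cmult_right[OF s[of \<nu>2 X], of "- exp \<epsilon>"]]
    by simp
  have ms: "f Y \<le> f P" if "Y \<subseteq> A" for Y
    unfolding f using that
    by (intro infsum_mono_neutral d) (auto simp: P_def)
  have PA: "P \<subseteq> A" by (auto simp: P_def)
  have "(SUP X\<in>Pow A. f X) = f P"
    using PA ms by (intro cSup_eq_maximum) auto
  then show ?thesis
    using ms PA by (intro exI[of _ P]) (auto simp: f_def skew_dist_def)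
qed

text \<open>The fresh element \<open>\<star>\<close> is \<open>None\<close>, and \<open>a \<in> A\<close> is embedded in \<open>star A\<close> as \<open>Some a\<close>.\<close>

definition star :: "'a set \<Rightarrow> 'a option set" where
  "star A = insert None (Some ` A)"

definition rel_star :: "'a set \<Rightarrow> 'b set \<Rightarrow> ('a \<times> 'b) set \<Rightarrow> ('a option \<times> 'b option) set" where
  "rel_star A1 A2 R =
     {(Some a, Some b) | a b. (a, b) \<in> R} \<union> (Some ` A1) \<times> {None} \<union> {None} \<times> (Some ` A2)"

text \<open>
  \<open>map_spmf Some \<mu>\<close> extends \<open>\<mu>\<close> by giving the point \<open>\<star>\<close> mass 0. The mass that an \<open>spmf\<close>
  lacks is not mass at \<open>\<star>\<close>, although \<open>'a spmf\<close> is built from \<open>'a option\<close> too.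
\<close>

definition approx_lifting ::
  "'a set \<Rightarrow> 'b set \<Rightarrow> ('a \<times> 'b) set \<Rightarrow> real \<Rightarrow> real \<Rightarrow> 'a spmf \<Rightarrow> 'b spmf \<Rightarrow> bool" where
  "approx_lifting A1 A2 R \<epsilon> \<delta> \<mu>1 \<mu>2 \<longleftrightarrow>
     (\<exists>\<mu>L \<in> subdists (star A1 \<times> star A2). \<exists>\<mu>R \<in> subdists (star A1 \<times> star A2).
        map_spmf fst \<mu>L = map_spmf Some \<mu>1 \<and>
        map_spmf snd \<mu>R = map_spmf Some \<mu>2 \<and>
        set_spmf \<mu>L \<union> set_spmf \<mu>R \<subseteq> rel_star A1 A2 R \<and>
        skew_dist (star A1 \<times> star A2) \<epsilon> \<mu>L \<mu>R \<le> \<delta>)"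

end

theory Submission
  imports Defs
begin

text \<open>
  From a lifting \<open>(\<mu>L, \<mu>R)\<close> one takes \<open>\<mu> = min \<mu>L \<mu>R\<close> on \<open>R\<close>; since \<open>exp \<epsilon> \<ge> 1\<close>, the excess
  \<open>\<mu>L - exp \<epsilon> * \<mu>\<close> is bounded by the positive part of \<open>\<mu>L - exp \<epsilon> * \<mu>R\<close>.
  Conversely, \<open>\<mu>R\<close> is \<open>\<mu>\<close> with the mass missing from its second marginal put on the points
  \<open>(\<star>, b)\<close>, while \<open>\<mu>L\<close> multiplies \<open>\<mu>(a, b)\<close> by the largest factor \<open>c a \<le> exp \<epsilon>\<close> that keeps the
  first marginal below \<open>\<mu>1\<close>, and puts the rest of \<open>\<mu>1\<close> on the points \<open>(a, \<star>)\<close>. Then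
  \<open>\<mu>L > exp \<epsilon> * \<mu>R\<close> happens only at those points, where the difference is the positive part of
  \<open>\<mu>1 a - exp \<epsilon> * (\<Sum>b. \<mu>(a, b))\<close>.
\<close>

section \<open>Sums of point masses over sets and fibres\<close>

lemma spmf_summable_on: "spmf p summable_on X"
proof -
  have "pmf p summable_on (Some ` X)"
    using pmf_abs_summable[of p "Some ` X"]
    by (simp add: abs_summable_equivalent[symmetric] abs_summable_summable)
  then show ?thesis by (subst (asm) summable_on_reindex) (auto simp: o_def)
qed

text \<open>\<open>has_sum\<close> records convergence together with the value, while
  \<open>infsum\<close> is 0 by default for a family that does not converge; hence this form for the
  sums below.\<close>

lemma has_sum_measure_spmf: "(spmf p has_sum measure (measure_spmf p) X) X"
  by (simp add: measure_spmf_eq_infsum spmf_summable_on)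

lemma has_sum_spmf_fst: "((\<lambda>b. spmf p (a, b)) has_sum spmf (map_spmf fst p) a) UNIV"
proof -
  have "(spmf p has_sum spmf (map_spmf fst p) a) (Pair a ` UNIV)"
    using has_sum_measure_spmf[of p "fst -` {a}"]
    unfolding spmf_map by (rule back_subst[where P = "\<lambda>S. (_ has_sum _) S"]) auto
  then show ?thesis by (subst (asm) has_sum_reindex) (auto simp: o_def inj_on_def)
qed

lemma has_sum_spmf_snd: "((\<lambda>a. spmf p (a, b)) has_sum spmf (map_spmf snd p) b) UNIV"
proof -
  have "(spmf p has_sum spmf (map_spmf snd p) b) ((\<lambda>a. (a, b)) ` UNIV)"
    using has_sum_measure_spmf[of p "snd -` {b}"]
    unfolding spmf_map by (rule back_subst[where P = "\<lambda>S. (_ has_sum _) S"]) auto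
  then show ?thesis by (subst (asm) has_sum_reindex) (auto simp: o_def inj_on_def)
qed

lemma measure_spmf_le_cmult:
  assumes "\<And>x. x \<in> S \<Longrightarrow> spmf p x \<le> c * spmf q x"
  shows "measure (measure_spmf p) S \<le> c * measure (measure_spmf q) S"
  by (rule has_sum_mono[OF has_sum_measure_spmf has_sum_cmult_right[OF has_sum_measure_spmf]])
     (rule assms)

lemma measure_spmf_ge_cmult:
  assumes "\<And>x. x \<in> S \<Longrightarrow> c * spmf q x \<le> spmf p x"
  shows "c * measure (measure_spmf q) S \<le> measure (measure_spmf p) S"
  by (rule has_sum_mono[OF has_sum_cmult_right[OF has_sum_measure_spmf] has_sum_measure_spmf])
     (rule assms)

lemma measure_spmf_image_cong:
  assumes "inj_on h S" "\<And>x. x \<in> S \<Longrightarrow> spmf p (h x) = spmf q x"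
  shows "measure (measure_spmf p) (h ` S) = measure (measure_spmf q) S"
  unfolding measure_spmf_eq_infsum using assms
  by (subst infsum_reindex) (auto intro: infsum_cong)

lemma measure_spmf_split:
  "measure (measure_spmf p) S = measure (measure_spmf p) (S \<inter> T) + measure (measure_spmf p) (S - T)"
  by (subst measure_spmf.finite_measure_Union[symmetric]) (auto simp: Int_Diff_Un)

section \<open>Sub-distributions with prescribed point masses\<close>

lemma ex_spmf_of_summable:
  fixes f :: "'a \<Rightarrow> real"
  assumes "\<And>x. f x \<ge> 0" "f summable_on UNIV" "infsum f UNIV \<le> 1"
  shows "\<exists>p. \<forall>x. spmf p x = f x"
proof -
  have abs: "Infinite_Set_Sum.abs_summable_on f UNIV"
    using assms(1,2) by (simp add: abs_summable_equivalent[symmetric] cong: summable_on_cong)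
  have "(\<integral>\<^sup>+ x. ennreal (f x) \<partial>count_space UNIV) = ennreal (infsetsum f UNIV)"
    by (rule nn_integral_conv_infsetsum[OF abs]) (rule assms)
  also have "\<dots> \<le> 1" using assms(3) infsetsum_infsum[OF abs] by simp
  finally show ?thesis using assms(1) by (intro exI[of _ "embed_spmf f"]) (simp add: max_def)
qed

text \<open>Summing each row first shows that \<open>f\<close> has the same total mass as
  \<open>p\<close>, hence at most 1: prescribing the marginal already makes \<open>f\<close> a
  sub-distribution.\<close>

lemma ex_spmf_with_fst:
  fixes f :: "'a \<times> 'b \<Rightarrow> real"
  assumes nonneg: "\<And>z. f z \<ge> 0"
    and sum: "\<And>x. ((\<lambda>y. f (x, y)) has_sum spmf p x) UNIV"
  shows "\<exists>q. (\<forall>z. spmf q z = f z) \<and> map_spmf fst q = p"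
proof -
  have s: "f summable_on UNIV \<times> UNIV"
    by (rule summable_on_SigmaI[OF sum spmf_summable_on]) (rule nonneg)
  have "(f has_sum measure (measure_spmf p) UNIV) (UNIV \<times> UNIV)"
    by (rule has_sum_SigmaI[OF sum has_sum_measure_spmf s])
  then have "infsum f UNIV \<le> 1"
    by (simp add: infsumI measure_spmf.subprob_measure_le_1)
  with s obtain q where q: "\<And>z. spmf q z = f z"
    using ex_spmf_of_summable[of f] nonneg by (metis UNIV_Times_UNIV)
  have "map_spmf fst q = p"
    by (rule spmf_eqI) (use has_sum_spmf_fst[of q] sum has_sum_unique in \<open>fastforce simp: q\<close>)
  with q show ?thesis by auto
qed

lemma ex_spmf_with_snd:
  fixes f :: "'a \<times> 'b \<Rightarrow> real"
  assumes nonneg: "\<And>z. f z \<ge> 0"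
    and sum: "\<And>y. ((\<lambda>x. f (x, y)) has_sum spmf p y) UNIV"
  shows "\<exists>q. (\<forall>z. spmf q z = f z) \<and> map_spmf snd q = p"
proof -
  have "\<exists>q. (\<forall>z. spmf q z = f (prod.swap z)) \<and> map_spmf fst q = p"
    by (rule ex_spmf_with_fst) (simp_all add: nonneg sum)
  then obtain q where q: "\<And>z. spmf q z = f (prod.swap z)" and p: "map_spmf fst q = p"
    by blast
  have "spmf (map_spmf prod.swap q) z = f z" for z
    using spmf_map_inj'[of prod.swap q "prod.swap z"] by (simp add: q)
  moreover have "map_spmf snd (map_spmf prod.swap q) = p"
    using p by (simp add: spmf.map_comp o_def)
  ultimately show ?thesis by blast
qed

lemma has_sum_option:
  fixes g :: "'a option \<Rightarrow> real"
  assumes "((\<lambda>x. g (Some x)) has_sum s) UNIV" "t = g None + s"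
  shows "(g has_sum t) UNIV"
  unfolding UNIV_option_conv assms(2)
  by (rule has_sum_insert) (use assms(1) in \<open>auto simp: has_sum_reindex o_def\<close>)

lemma spmf_map_Some:
  "spmf (map_spmf Some p) (Some x) = spmf p x" "spmf (map_spmf Some p) None = 0"
  by (metis inj_Some spmf_map_inj') (simp add: spmf_map vimage_def)

text \<open>The supremum is attained, so bounding it amounts to bounding the difference on each set
  separately.\<close>

lemma skew_dist_le_iff:
  "skew_dist A \<epsilon> p q \<le> \<delta> \<longleftrightarrow>
     (\<forall>X\<subseteq>A. measure (measure_spmf p) X - exp \<epsilon> * measure (measure_spmf q) X \<le> \<delta>)"
  using skew_dist_attained[of A p \<epsilon> q] by (smt (verit))

text \<open>A point weighs no more than its fibre under \<open>h\<close>, so a marginal that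
  vanishes at a point makes the whole fibre vanish.\<close>

lemma spmf_map_eq_0: "spmf (map_spmf h p) (h x) = 0 \<Longrightarrow> spmf p x = 0"
  by (metis in_set_spmf_iff_spmf set_map_spmf image_eqI)

section \<open>From a lifting to a witness\<close>

text \<open>Let \<open>Z\<close> be the set of pairs above \<open>X\<close>, and split it along
  \<open>T\<close>, where \<open>exp \<epsilon> * q \<le> p\<close>. Off \<open>T\<close>,
  \<open>p\<close> is at most \<open>exp \<epsilon> * m'\<close>; on \<open>T\<close>,
  \<open>m'\<close> dominates \<open>q\<close>. So the difference on \<open>X\<close> is at most
  that of \<open>p\<close> and \<open>q\<close> on \<open>Z \<inter> T\<close>.\<close>

lemma approx_lifting_imp_witness:
  assumes "approx_lifting A1 A2 R \<epsilon> \<delta> \<mu>1 \<mu>2" "0 \<le> \<epsilon>"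
  shows "\<exists>m. (\<forall>a. spmf (map_spmf fst m) a \<le> spmf \<mu>1 a) \<and>
             (\<forall>b. spmf (map_spmf snd m) b \<le> spmf \<mu>2 b) \<and>
             set_spmf m \<subseteq> R \<and> skew_dist A1 \<epsilon> \<mu>1 (map_spmf fst m) \<le> \<delta>"
proof -
  obtain p q where pq: "p \<in> subdists (star A1 \<times> star A2)"
    "map_spmf fst p = map_spmf Some \<mu>1" "map_spmf snd q = map_spmf Some \<mu>2"
    "set_spmf p \<subseteq> rel_star A1 A2 R"
    "skew_dist (star A1 \<times> star A2) \<epsilon> p q \<le> \<delta>"
    using assms(1) unfolding approx_lifting_def by auto
  have q0: "spmf q (x, None) = 0" for x
    by (rule spmf_map_eq_0[of snd]) (simp add: pq spmf_map_Some)
  have e: "exp \<epsilon> \<ge> 1" using assms(2) by simp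
  let ?h = "map_prod Some Some :: 'a \<times> 'b \<Rightarrow> 'a option \<times> 'b option"
  have inj: "inj ?h" by (simp add: prod.inj_map)
  define f where "f z = min (spmf p (?h z)) (spmf q (?h z))" for z
  have sp: "((\<lambda>z. spmf p (?h z)) has_sum measure (measure_spmf p) (range ?h)) UNIV"
    using has_sum_measure_spmf[of p "range ?h"] unfolding has_sum_reindex[OF inj] o_def .
  have sf: "f summable_on UNIV"
    by (rule summable_on_comparison_test[OF has_sum_imp_summable[OF sp]]) (auto simp: f_def)
  have "infsum f UNIV \<le> measure (measure_spmf p) (range ?h)"
    by (rule has_sum_mono[OF has_sum_infsum[OF sf] sp]) (auto simp: f_def)
  also have "\<dots> \<le> 1" by (rule measure_spmf.subprob_measure_le_1)
  finally obtain m where m: "\<And>z. spmf m z = f z"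
    using ex_spmf_of_summable[OF _ sf] by (metis f_def min_def pmf_nonneg)
  \<comment> \<open>\<open>m'\<close> is \<open>m\<close> moved to the starred space, where it can
    be compared with \<open>p\<close> and \<open>q\<close> point by point; it has no mass at points
    with a \<open>None\<close> component.\<close>
  define m' where "m' = map_spmf ?h m"
  have m'_Some: "spmf m' (Some a, Some b) = min (spmf p (Some a, Some b)) (spmf q (Some a, Some b))"
    for a b
    using spmf_map_inj'[OF inj, of m "(a, b)"] by (simp add: m'_def m f_def)
  have m'_None: "spmf m' (x, y) = 0" if "x = None \<or> y = None" for x y
    using that by (auto simp: m'_def spmf_eq_0_set_spmf)
  have le_p: "spmf m' z \<le> spmf p z" and le_q: "spmf m' z \<le> spmf q z" for z
    by (cases z; cases "fst z"; cases "snd z"; auto simp: m'_Some m'_None)+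
  have fst_m': "map_spmf fst m' = map_spmf Some (map_spmf fst m)"
    and snd_m': "map_spmf snd m' = map_spmf Some (map_spmf snd m)"
    by (simp_all add: m'_def spmf.map_comp o_def)
  have "spmf (map_spmf fst m') x \<le> spmf (map_spmf fst p) x" for x
    unfolding spmf_map using measure_spmf_le_cmult[of _ m' 1 p] le_p by simp
  then have fst_le: "spmf (map_spmf fst m) a \<le> spmf \<mu>1 a" for a
    using spmf_map_Some(1) by (metis fst_m' pq(2))
  have "spmf (map_spmf snd m') x \<le> spmf (map_spmf snd q) x" for x
    unfolding spmf_map using measure_spmf_le_cmult[of _ m' 1 q] le_q by simp
  then have snd_le: "spmf (map_spmf snd m) b \<le> spmf \<mu>2 b" for b
    using spmf_map_Some(1) by (metis snd_m' pq(3))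
  have "z \<in> R" if "z \<in> set_spmf m" for z
  proof -
    have "spmf p (?h z) \<noteq> 0"
      using that by (auto simp: in_set_spmf_iff_spmf m f_def min_def split: if_splits)
    then have "?h z \<in> rel_star A1 A2 R" using pq(4) by (auto simp: in_set_spmf_iff_spmf)
    then show ?thesis by (cases z) (auto simp: rel_star_def)
  qed
  moreover have "skew_dist A1 \<epsilon> \<mu>1 (map_spmf fst m) \<le> \<delta>"
    unfolding skew_dist_le_iff
  proof (intro allI impI)
    fix X assume "X \<subseteq> A1"
    define Z :: "('a option \<times> 'b option) set" where "Z = fst -` (Some ` X)"
    define T where "T = (star A1 \<times> star A2) \<inter> {z. exp \<epsilon> * spmf q z \<le> spmf p z}"
    have pZ: "measure (measure_spmf \<mu>1) X = measure (measure_spmf p) Z"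
    proof -
      have "measure (measure_spmf p) Z = measure (measure_spmf (map_spmf fst p)) (Some ` X)"
        by (simp add: Z_def measure_map_spmf)
      then show ?thesis by (simp add: pq measure_map_spmf inj_vimage_image_eq)
    qed
    have mZ: "measure (measure_spmf (map_spmf fst m)) X = measure (measure_spmf m') Z"
    proof -
      have "measure (measure_spmf m') Z = measure (measure_spmf (map_spmf fst m')) (Some ` X)"
        by (simp add: Z_def measure_map_spmf)
      also have "\<dots> = measure (measure_spmf (map_spmf fst m)) X"
        unfolding fst_m' measure_map_spmf[of Some] by (simp add: inj_vimage_image_eq)
      finally show ?thesis by simp
    qed
    have "measure (measure_spmf p) (Z - T) \<le> exp \<epsilon> * measure (measure_spmf m') (Z - T)"
    proof (rule measure_spmf_le_cmult)
      fix z assume z: "z \<in> Z - T"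
      show "spmf p z \<le> exp \<epsilon> * spmf m' z"
      proof (cases "z \<in> star A1 \<times> star A2")
        case False
        then have "spmf p z = 0" using pq(1) by (auto simp: subdists_def spmf_eq_0_set_spmf)
        then show ?thesis by simp
      next
        case True
        with z have lt: "spmf p z < exp \<epsilon> * spmf q z" by (auto simp: T_def)
        \<comment> \<open>A second component \<open>None\<close> is impossible here:
          \<open>q0\<close> would turn \<open>lt\<close> into \<open>spmf p z < 0\<close>.\<close>
        with z obtain a b where ab: "z = (Some a, Some b)"
          using q0 by (cases z; cases "snd z") (auto simp: Z_def not_less[symmetric])
        have "spmf p z \<le> exp \<epsilon> * spmf p z" using e by (simp add: mult_le_cancel_right1)
        with lt show ?thesis unfolding ab m'_Some by (auto simp: min_def)
      qed
    qed
    moreover have "exp \<epsilon> * measure (measure_spmf q) (Z \<inter> T)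
        \<le> exp \<epsilon> * measure (measure_spmf m') (Z \<inter> T)"
    proof -
      have "spmf q z \<le> spmf m' z" if z: "z \<in> Z \<inter> T" for z
      proof (cases "snd z")
        case None
        then show ?thesis using q0 by (cases z) auto
      next
        case (Some b)
        with z obtain a where ab: "z = (Some a, Some b)" by (cases z) (auto simp: Z_def)
        \<comment> \<open>Since \<open>exp \<epsilon> \<ge> 1\<close>, membership in
          \<open>T\<close> gives \<open>q \<le> p\<close>, so the minimum defining \<open>m'\<close>
          is \<open>q\<close>.\<close>
        have "spmf q z \<le> exp \<epsilon> * spmf q z" using e by (simp add: mult_le_cancel_right1)
        also have "\<dots> \<le> spmf p z" using z by (auto simp: T_def)
        finally show ?thesis unfolding ab m'_Some by simp
      qed
      then show ?thesis using measure_spmf_le_cmult[of "Z \<inter> T" q 1 m'] by simp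
    qed
    moreover have "measure (measure_spmf p) (Z \<inter> T)
        - exp \<epsilon> * measure (measure_spmf q) (Z \<inter> T) \<le> \<delta>"
      by (rule pq(5)[unfolded skew_dist_le_iff, rule_format]) (auto simp: T_def)
    ultimately show "measure (measure_spmf \<mu>1) X
        - exp \<epsilon> * measure (measure_spmf (map_spmf fst m)) X \<le> \<delta>"
      unfolding pZ mZ measure_spmf_split[of p Z T] measure_spmf_split[of m' Z T] distrib_left
      by linarith
  qed
  ultimately show ?thesis using fst_le snd_le by blast
qed

section \<open>From a witness to a lifting\<close>

text \<open>For a test set \<open>Y\<close>, only its part \<open>W\<close> in the column
  \<open>None\<close> can make \<open>p\<close> exceed \<open>e * q\<close>, so the difference on
  \<open>Y\<close> is at most \<open>p\<close> of \<open>W\<close>. The mass of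
  \<open>\<mu>1\<close> on \<open>X\<close> splits between \<open>W\<close> and the starless pairs
  \<open>V\<close> above \<open>X\<close>; on \<open>V\<close>, \<open>p\<close> is at least
  \<open>e * q\<close>, which leaves the difference for \<open>\<mu>1\<close> and the first marginal
  of \<open>m\<close> on \<open>X\<close>.\<close>

lemma witness_imp_approx_lifting:
  assumes m1: "\<And>a. spmf (map_spmf fst m) a \<le> spmf \<mu>1 a"
    and m2: "\<And>b. spmf (map_spmf snd m) b \<le> spmf \<mu>2 b"
    and R: "set_spmf m \<subseteq> R" "R \<subseteq> A1 \<times> A2"
    and d: "skew_dist A1 \<epsilon> \<mu>1 (map_spmf fst m) \<le> \<delta>"
    and \<mu>: "\<mu>1 \<in> subdists A1" "\<mu>2 \<in> subdists A2"
  shows "approx_lifting A1 A2 R \<epsilon> \<delta> \<mu>1 \<mu>2"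
proof -
  define e where "e = exp \<epsilon>"
  have e: "e > 0" by (simp add: e_def)
  let ?m1 = "spmf (map_spmf fst m)" and ?m2 = "spmf (map_spmf snd m)"
  \<comment> \<open>If \<open>?m1 a = 0\<close>, division by zero gives \<open>c a = 0\<close>. This
    is harmless, as \<open>m\<close> then vanishes on the row of \<open>a\<close>; \<open>cm\<close>
    holds in both cases, but \<open>c_eq\<close> must exclude this one.\<close>
  define c where "c a = min e (spmf \<mu>1 a / ?m1 a)" for a
  have c: "0 \<le> c a" "c a \<le> e" for a using e by (auto simp: c_def)
  have cm: "c a * ?m1 a = min (spmf \<mu>1 a) (e * ?m1 a)" for a
    using e by (cases "?m1 a = 0") (auto simp: c_def min_def field_simps)
  have c_eq: "c a = e" if "e * ?m1 a \<le> spmf \<mu>1 a" "?m1 a \<noteq> 0" for a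
    using cm[of a] that by (simp add: min_def split: if_splits)
  \<comment> \<open>The zero row of \<open>fL\<close> and the zero column of \<open>fR\<close> at
    \<open>None\<close> are forced by the marginals, which have no mass at
    \<open>None\<close>.\<close>
  define fL where "fL = (\<lambda>(x, y). case x of None \<Rightarrow> 0 | Some a \<Rightarrow>
    (case y of None \<Rightarrow> spmf \<mu>1 a - c a * ?m1 a | Some b \<Rightarrow> c a * spmf m (a, b)))"
  define fR where "fR = (\<lambda>(x, y). case y of None \<Rightarrow> 0 | Some b \<Rightarrow>
    (case x of None \<Rightarrow> spmf \<mu>2 b - ?m2 b | Some a \<Rightarrow> spmf m (a, b)))"
  have "\<exists>p. (\<forall>z. spmf p z = fL z) \<and> map_spmf fst p = map_spmf Some \<mu>1"
  proof (rule ex_spmf_with_fst)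
    show "fL z \<ge> 0" for z
      using c cm by (auto simp: fL_def split: prod.splits option.splits)
    show "((\<lambda>y. fL (x, y)) has_sum spmf (map_spmf Some \<mu>1) x) UNIV" for x
    proof (cases x)
      case None
      then show ?thesis by (simp add: fL_def spmf_map_Some)
    next
      case (Some a)
      show ?thesis unfolding Some
        by (rule has_sum_option[where s = "c a * ?m1 a"])
           (auto simp: fL_def spmf_map_Some intro!: has_sum_cmult_right has_sum_spmf_fst)
    qed
  qed
  then obtain p where p: "\<And>z. spmf p z = fL z" "map_spmf fst p = map_spmf Some \<mu>1" by blast
  have "\<exists>q. (\<forall>z. spmf q z = fR z) \<and> map_spmf snd q = map_spmf Some \<mu>2"
  proof (rule ex_spmf_with_snd)
    show "fR z \<ge> 0" for z
      using m2 by (auto simp: fR_def split: prod.splits option.splits)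
    show "((\<lambda>x. fR (x, y)) has_sum spmf (map_spmf Some \<mu>2) y) UNIV" for y
    proof (cases y)
      case None
      then show ?thesis by (simp add: fR_def spmf_map_Some)
    next
      case (Some b)
      show ?thesis unfolding Some
        by (rule has_sum_option[where s = "?m2 b"])
           (auto simp: fR_def spmf_map_Some intro!: has_sum_spmf_snd)
    qed
  qed
  then obtain q where q: "\<And>z. spmf q z = fR z" "map_spmf snd q = map_spmf Some \<mu>2" by blast
  have m1_0: "spmf m (a, b) = 0" if "?m1 a = 0" for a b
    using spmf_map_eq_0[of fst m "(a, b)"] that by simp
  have mR: "(a, b) \<in> R" if "spmf m (a, b) \<noteq> 0" for a b
    using that R by (auto simp: in_set_spmf_iff_spmf)
  have A1: "a \<in> A1" if "spmf \<mu>1 a \<noteq> 0" for a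
    using that \<mu> by (auto simp: in_set_spmf_iff_spmf subdists_def)
  have A2: "b \<in> A2" if "spmf \<mu>2 b \<noteq> 0" for b
    using that \<mu> by (auto simp: in_set_spmf_iff_spmf subdists_def)
  have m1_zero: "?m1 a = 0" if "spmf \<mu>1 a = 0" for a
    using m1[of a] that by (simp add: order_antisym)
  have m2_zero: "?m2 b = 0" if "spmf \<mu>2 b = 0" for b
    using m2[of b] that by (simp add: order_antisym)
  have "z \<in> rel_star A1 A2 R" if "fL z \<noteq> 0" for z
    \<comment> \<open>For a component \<open>None\<close>, \<open>the\<close> is unspecified, but
      the instantiated facts hold for every element and remain valid.\<close>
    using that mR[of "the (fst z)" "the (snd z)"] A1[of "the (fst z)"] m1_zero[of "the (fst z)"]
    by (cases "spmf \<mu>1 (the (fst z)) = 0")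
       (auto simp: fL_def rel_star_def split: prod.splits option.splits)
  moreover have "z \<in> rel_star A1 A2 R" if "fR z \<noteq> 0" for z
    using that mR[of "the (fst z)" "the (snd z)"] A2[of "the (snd z)"] m2_zero[of "the (snd z)"]
    by (cases "spmf \<mu>2 (the (snd z)) = 0")
       (auto simp: fR_def rel_star_def split: prod.splits option.splits)
  ultimately have supp: "set_spmf p \<union> set_spmf q \<subseteq> rel_star A1 A2 R"
    using p(1) q(1) by (auto simp: in_set_spmf_iff_spmf)
  have "rel_star A1 A2 R \<subseteq> star A1 \<times> star A2"
    using R by (auto simp: rel_star_def star_def)
  moreover have "skew_dist (star A1 \<times> star A2) \<epsilon> p q \<le> \<delta>"
    unfolding skew_dist_le_iff e_def[symmetric]
  proof (intro allI impI)
    fix Y :: "('a option \<times> 'b option) set"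
    \<comment> \<open>\<open>X\<close> indexes the points of \<open>Y\<close> where \<open>p\<close>
      may exceed \<open>e * q\<close>. The rows \<open>V\<close> above it need not lie in
      \<open>Y\<close>: they serve only to compute \<open>p\<close> of \<open>W\<close>.\<close>
    define X where "X = {a\<in>A1. (Some a, None) \<in> Y \<and> e * ?m1 a \<le> spmf \<mu>1 a}"
    define W :: "('a option \<times> 'b option) set" where "W = (\<lambda>a. (Some a, None)) ` X"
    define V :: "('a option \<times> 'b option) set" where "V = map_prod Some Some ` (X \<times> UNIV)"
    define Z :: "('a option \<times> 'b option) set" where "Z = fst -` (Some ` X)"
    have "measure (measure_spmf p) (Y - W) \<le> e * measure (measure_spmf q) (Y - W)"
    proof (rule measure_spmf_le_cmult)
      fix z assume z: "z \<in> Y - W"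
      show "spmf p z \<le> e * spmf q z"
      proof (cases "\<exists>a. z = (Some a, None)")
        case True
        then obtain a where a: "z = (Some a, None)" by blast
        with z have "a \<notin> X" by (auto simp: W_def)
        \<comment> \<open>An element outside \<open>X\<close> may also fail to be in
          \<open>A1\<close>; then \<open>spmf \<mu>1 a = 0\<close> and the bound is trivial.\<close>
        with z a have "spmf \<mu>1 a \<le> e * ?m1 a"
          using A1[of a] e by (cases "spmf \<mu>1 a = 0") (auto simp: X_def)
        then show ?thesis by (simp add: a p q fL_def fR_def cm)
      next
        case False
        then show ?thesis using c e m2
          by (auto simp: p q fL_def fR_def mult_right_mono split: prod.splits option.splits)
      qed
    qed
    moreover have "e * measure (measure_spmf q) V \<le> measure (measure_spmf p) V"
    proof (rule measure_spmf_ge_cmult)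
      fix z assume "z \<in> V"
      then obtain a b where "z = (Some a, Some b)" "e * ?m1 a \<le> spmf \<mu>1 a"
        by (auto simp: V_def X_def)
      \<comment> \<open>Either the row of \<open>a\<close> carries no mass of \<open>m\<close>, or
        \<open>c a = e\<close> and equality holds.\<close>
      then show "e * spmf q z \<le> spmf p z"
        using c_eq[of a] m1_0[of a b] by (cases "?m1 a = 0") (auto simp: p q fL_def fR_def)
    qed
    moreover have "measure (measure_spmf q) V = measure (measure_spmf (map_spmf fst m)) X"
    proof -
      have "measure (measure_spmf q) V = measure (measure_spmf m) (X \<times> UNIV)"
        unfolding V_def
        by (rule measure_spmf_image_cong) (auto simp: inj_on_def q fR_def)
      also have "X \<times> UNIV = fst -` X" by auto
      finally show ?thesis by (simp add: measure_map_spmf)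
    qed
    moreover have "measure (measure_spmf \<mu>1) X = measure (measure_spmf p) W + measure (measure_spmf p) V"
    proof -
      have "measure (measure_spmf p) Z = measure (measure_spmf (map_spmf fst p)) (Some ` X)"
        by (simp add: Z_def measure_map_spmf)
      then have "measure (measure_spmf p) Z = measure (measure_spmf \<mu>1) X"
        by (simp add: p measure_map_spmf inj_vimage_image_eq)
      moreover have "Z \<inter> V = V" by (auto simp: Z_def V_def)
      moreover have "Z - V = W"
        by (auto simp: Z_def V_def W_def image_iff)
      ultimately show ?thesis using measure_spmf_split[of p Z V] by simp
    qed
    moreover have "measure (measure_spmf \<mu>1) X - e * measure (measure_spmf (map_spmf fst m)) X \<le> \<delta>"
      using d unfolding skew_dist_le_iff e_def by (auto simp: X_def)
    moreover have "Y \<inter> W = W" by (auto simp: W_def X_def)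
    moreover have "0 \<le> e * measure (measure_spmf q) W" using e by simp
    ultimately show "measure (measure_spmf p) Y - e * measure (measure_spmf q) Y \<le> \<delta>"
      using measure_spmf_split[of p Y W] measure_spmf_split[of q Y W] by (simp add: algebra_simps)
  qed
  ultimately show ?thesis
    unfolding approx_lifting_def using supp p(2) q(2) by (fastforce simp: subdists_def)
qed

theorem theorem5p38:
  fixes A1 :: "'a set" and A2 :: "'b set" and R :: "('a \<times> 'b) set"
    and \<mu>1 :: "'a spmf" and \<mu>2 :: "'b spmf" and \<epsilon> \<delta> :: real
  assumes "countable A1" and "countable A2"
    and "\<mu>1 \<in> subdists A1" and "\<mu>2 \<in> subdists A2"
    and "R \<subseteq> A1 \<times> A2"
    and "0 \<le> \<epsilon>"
  shows "(\<exists>\<mu> \<in> subdists (A1 \<times> A2).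
            (\<forall>a\<in>A1. spmf (map_spmf fst \<mu>) a \<le> spmf \<mu>1 a) \<and>
            (\<forall>b\<in>A2. spmf (map_spmf snd \<mu>) b \<le> spmf \<mu>2 b) \<and>
            set_spmf \<mu> \<subseteq> R \<and>
            skew_dist A1 \<epsilon> \<mu>1 (map_spmf fst \<mu>) \<le> \<delta>)
         \<longleftrightarrow> approx_lifting A1 A2 R \<epsilon> \<delta> \<mu>1 \<mu>2" (is "?lhs \<longleftrightarrow> ?rhs")
proof
  assume ?lhs
  then obtain m where m: "m \<in> subdists (A1 \<times> A2)"
    "\<forall>a\<in>A1. spmf (map_spmf fst m) a \<le> spmf \<mu>1 a"
    "\<forall>b\<in>A2. spmf (map_spmf snd m) b \<le> spmf \<mu>2 b"
    "set_spmf m \<subseteq> R" "skew_dist A1 \<epsilon> \<mu>1 (map_spmf fst m) \<le> \<delta>" by blast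
  \<comment> \<open>The bounds are given on \<open>A1\<close> and \<open>A2\<close> only; elsewhere
    the marginals of \<open>m\<close> vanish by its support.\<close>
  have "spmf (map_spmf fst m) a \<le> spmf \<mu>1 a" for a
  proof (cases "a \<in> A1")
    case False
    then have "spmf (map_spmf fst m) a = 0"
      using m(1) by (auto simp: spmf_eq_0_set_spmf subdists_def)
    then show ?thesis by simp
  qed (use m in blast)
  moreover have "spmf (map_spmf snd m) b \<le> spmf \<mu>2 b" for b
  proof (cases "b \<in> A2")
    case False
    then have "spmf (map_spmf snd m) b = 0"
      using m(1) by (auto simp: spmf_eq_0_set_spmf subdists_def)
    then show ?thesis by simp
  qed (use m in blast)
  ultimately show ?rhs
    using witness_imp_approx_lifting m assms by blast
next
  assume ?rhs
  then show ?lhs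
    using approx_lifting_imp_witness assms unfolding subdists_def
    by (smt (verit) mem_Collect_eq order_trans)
qed

end
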